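(* Let $m\ge0$ and $\theta\in(-\frac{\pi}{2},\frac{\pi}{2})$. For every $\vartheta\in(-\frac{\theta}{2},\frac{\theta}{2})\setminus\{0\}$ (the interval being empty if $\theta\le0$), $$\lim_{r\to+\infty}\big\|\big(H_\theta-m-re^{i\vartheta}\big)^{-1}\big\|=\infty\qquad\text{and}\qquad\lim_{r\to-\infty}\big\|\big(H_\theta+m-re^{i\vartheta}\big)^{-1}\big\|=\infty.$$
   Context: Pauli matrices: $\sigma_1=\begin{pmatrix}0&1\\1&0\end{pmatrix}$, $\sigma_2=\begin{pmatrix}0&-i\\i&0\end{pmatrix}$, $\sigma_3=\begin{pmatrix}1&0\\0&-1\end{pmatrix}$; Dirac matrices $\alpha_k=\begin{pmatrix}0&\sigma_k\\\sigma_k&0\end{pmatrix}$, $k=1,2,3$. For $m\ge0$ and $|\theta|<\frac{\pi}{2}$, the operator $H_\theta$ acts in $L^2(\mathbb{R})^4=L^2(\mathbb{R};\mathbb{C}^4)$ by $$H_\theta=-i\alpha_1e^{-i\theta/2}\partial_x-\alpha_2e^{i\theta/2}x+m\alpha_3,\qquad \mathsf{D}(H_\theta)=\mathcal{D}^4,\quad \mathcal{D}=H^1(\mathbb{R})\cap L^2(\mathbb{R},x^2\,dx).$$ It is closed with real spectrum, so the resolvents in the claim exist for $r\neq0$. *)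

theory Defs
  imports "HOL-Analysis.Analysis"
begin

subsection \<open>Pauli and Dirac matrices\<close>

definition pauli1 :: "complex^2^2" where
  "pauli1 = vector [vector [0, 1], vector [1, 0]]"

definition pauli2 :: "complex^2^2" where
  "pauli2 = vector [vector [0, - \<i>], vector [\<i>, 0]]"

definition pauli3 :: "complex^2^2" where
  "pauli3 = vector [vector [1, 0], vector [0, - 1]]"

definition antidiag_block :: "complex^2^2 \<Rightarrow> complex^4^4" where
  "antidiag_block s = vector
     [vector [0, 0, s $ 1 $ 1, s $ 1 $ 2],
      vector [0, 0, s $ 2 $ 1, s $ 2 $ 2],
      vector [s $ 1 $ 1, s $ 1 $ 2, 0, 0],
      vector [s $ 2 $ 1, s $ 2 $ 2, 0, 0]]"

definition dirac1 :: "complex^4^4" where "dirac1 = antidiag_block pauli1"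
definition dirac2 :: "complex^4^4" where "dirac2 = antidiag_block pauli2"
definition dirac3 :: "complex^4^4" where "dirac3 = antidiag_block pauli3"


subsection \<open>Square-integrable functions and weak derivatives on the real line\<close>

text \<open>
  Elements of \<open>L\<^sup>2(\<real>; V)\<close> are handled through Borel measurable representatives; equality of elements
  is equality almost everywhere, and \<open>L2_norm\<close> is the norm of the class.
\<close>

definition square_integrable :: "(real \<Rightarrow> 'a::euclidean_space) \<Rightarrow> bool" where
  "square_integrable u \<longleftrightarrow>
     u \<in> borel_measurable lborel \<and> integrable lborel (\<lambda>x. (norm (u x))\<^sup>2)"

definition L2_norm :: "(real \<Rightarrow> 'a::euclidean_space) \<Rightarrow> real" where
  "L2_norm u = sqrt (LINT x|lborel. (norm (u x))\<^sup>2)"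

definition test_function :: "(real \<Rightarrow> real) \<Rightarrow> bool" where
  "test_function \<phi> \<longleftrightarrow>
     (\<forall>n x. (deriv ^^ n) \<phi> differentiable (at x)) \<and> compact (closure {x. \<phi> x \<noteq> 0})"

text \<open>
  Both functions are required to be square-integrable, so that all integrals below converge.
\<close>

definition has_L2_weak_derivative ::
    "(real \<Rightarrow> 'a::euclidean_space) \<Rightarrow> (real \<Rightarrow> 'a) \<Rightarrow> bool" where
  "has_L2_weak_derivative u u' \<longleftrightarrow>
     square_integrable u \<and> square_integrable u' \<and>
     (\<forall>\<phi>. test_function \<phi> \<longrightarrow>
        (LINT x|lborel. deriv \<phi> x *\<^sub>R u x) = - (LINT x|lborel. \<phi> x *\<^sub>R u' x))"

definition sobolev_H1 :: "(real \<Rightarrow> complex) set" where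
  "sobolev_H1 = {u. \<exists>u'. has_L2_weak_derivative u u'}"

definition weighted_L2 :: "(real \<Rightarrow> complex) set" where
  "weighted_L2 =
     {u \<in> borel_measurable lborel. integrable lborel (\<lambda>x. (norm (u x))\<^sup>2 * x\<^sup>2)}"


subsection \<open>Operators in \<open>L\<^sup>2(\<real>; \<complex>\<^sup>4)\<close>\<close>

text \<open>
  A possibly unbounded operator is given by its graph, a set of pairs of representatives; so the
  inverse operator is the converse relation.
\<close>

type_synonym L2_operator = "((real \<Rightarrow> complex^4) \<times> (real \<Rightarrow> complex^4)) set"

definition subtract_scalar :: "L2_operator \<Rightarrow> complex \<Rightarrow> L2_operator" where
  "subtract_scalar T z = {(u, \<lambda>x. f x - z *s u x) |u f. (u, f) \<in> T}"

definition resolvent :: "L2_operator \<Rightarrow> complex \<Rightarrow> L2_operator" where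
  "resolvent T z = (subtract_scalar T z)\<inverse>"

definition operator_norm :: "L2_operator \<Rightarrow> ennreal" where
  "operator_norm T = (SUP (f, u) \<in> {(f, u) \<in> T. L2_norm f \<le> 1}. ennreal (L2_norm u))"


subsection \<open>The operator \<open>H\<^sub>\<theta>\<close>\<close>

definition H_domain :: "(real \<Rightarrow> complex^4) set" where
  "H_domain = {u. \<forall>i. (\<lambda>x. u x $ i) \<in> sobolev_H1 \<inter> weighted_L2}"

definition H_op :: "real \<Rightarrow> real \<Rightarrow> L2_operator" where
  "H_op m \<theta> = {(u, f). u \<in> H_domain \<and> square_integrable f \<and>
     (\<exists>u'. has_L2_weak_derivative u u' \<and>
       (AE x in lborel. f x =
          (- \<i> * exp (- \<i> * of_real \<theta> / 2)) *s (dirac1 *v u' x)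
          - (exp (\<i> * of_real \<theta> / 2) * of_real x) *s (dirac2 *v u x)
          + of_real m *s (dirac3 *v u x)))}"

end

theory Submission
  imports Defs "HOL-Probability.Distributions"
begin

text \<open>
  On spinors \<open>(v, v)\<close> the operator acts as the two-component operator
  \<open>D = [[m, i A'], [- i A, - m]]\<close> with \<open>A = e\<^sup>-\<^sup>1 \<partial> + e x\<close>, \<open>A' = - e\<^sup>-\<^sup>1 \<partial> + e x\<close>, \<open>e = exp (i \<theta> / 2)\<close>, and
  \<open>(D - z) (D + z) (g, 0) = ((A' A + m\<^sup>2 - z\<^sup>2) g, 0)\<close>, where \<open>A' A + 1\<close> is the complex harmonic oscillator
  with symbol \<open>exp (- i \<theta>) \<xi>\<^sup>2 + exp (i \<theta>) x\<^sup>2\<close>.  For a Gaussian coherent state \<open>g\<close>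
  centred at a real phase-space point where the symbol is approximately \<open>z\<^sup>2\<close>, with complex width chosen to
  cancel the linear term of the symbol, the residual \<open>(A' A + m\<^sup>2 - z\<^sup>2) g\<close> is bounded uniformly in \<open>r\<close>.
  Since \<open>(D + z) (g, 0)\<close> has norm at least \<open>\<bar>z + m\<bar> \<parallel>g\<parallel>\<close>, the resolvent norm grows at least linearly.
\<close>

section \<open>Classical derivatives and square-integrability\<close>

text \<open>Integration by parts on a compact interval containing the support of the test function;
  the boundary terms vanish.\<close>

lemma has_L2_weak_derivative_of_C1:
  fixes u u' :: "real \<Rightarrow> 'a::euclidean_space"
  assumes u: "square_integrable u" and u': "square_integrable u'"
    and deriv: "\<And>x. (u has_vector_derivative u' x) (at x)" and cont: "continuous_on UNIV u'"
  shows "has_L2_weak_derivative u u'"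
proof -
  have "(LINT x|lborel. deriv \<phi> x *\<^sub>R u x) = - (LINT x|lborel. \<phi> x *\<^sub>R u' x)"
    if \<phi>: "test_function \<phi>" for \<phi>
  proof -
    have diff: "(deriv ^^ n) \<phi> differentiable (at x)" for n x
      using \<phi> by (auto simp: test_function_def)
    have D: "(\<phi> has_vector_derivative deriv \<phi> x) (at x)" for x
      using diff[of 0 x]
      by (simp add: real_differentiable_def DERIV_imp_deriv has_real_derivative_iff_has_vector_derivative[symmetric])
        (metis DERIV_imp_deriv)
    have cont_\<phi>: "continuous_on A \<phi>" for A
      using diff[of 0] by (auto intro!: continuous_at_imp_continuous_on differentiable_imp_continuous_within)
    have cont_\<phi>': "continuous_on A (deriv \<phi>)" for A
      using diff[of 1] by (auto intro!: continuous_at_imp_continuous_on differentiable_imp_continuous_within)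
    have cont_u: "continuous_on A u" for A
      using deriv by (auto intro!: continuous_at_imp_continuous_on has_vector_derivative_continuous)
    have cont_u': "continuous_on A u'" for A
      using cont continuous_on_subset by blast
    have "bounded (closure {x. \<phi> x \<noteq> 0})"
      using \<phi> compact_imp_bounded by (auto simp: test_function_def)
    then obtain R where R: "\<And>x. x \<in> closure {x. \<phi> x \<noteq> 0} \<Longrightarrow> \<bar>x\<bar> \<le> R" and "R > 0"
      by (auto simp: bounded_pos)
    have out: "\<phi> x = 0" if "\<bar>x\<bar> > R" for x
      using R[of x] that closure_subset[of "{x. \<phi> x \<noteq> 0}"] by force
    have out': "deriv \<phi> x = 0" if "\<bar>x\<bar> > R" for x
    proof -
      have "open {x::real. \<bar>x\<bar> > R}"
        by (intro open_Collect_less continuous_intros)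
      then have "eventually (\<lambda>x. \<phi> x = 0) (nhds x)"
        unfolding eventually_nhds using that out by blast
      then have "deriv \<phi> x = deriv (\<lambda>x. 0) x"
        by (intro deriv_cong_ev) auto
      then show ?thesis by simp
    qed
    \<comment> \<open>The margin \<open>1\<close> puts both endpoints strictly outside the support,
      so that \<open>\<phi>\<close> vanishes there.\<close>
    define I where "I = {- (R + 1) .. R + 1}"
    have \<phi>_eq: "\<phi> x *\<^sub>R v = indicator I x *\<^sub>R (\<phi> x *\<^sub>R v)" for x and v :: 'a
      using out[of x] \<open>R > 0\<close> by (cases "\<bar>x\<bar> > R") (auto simp: I_def indicator_def)
    have \<phi>'_eq: "deriv \<phi> x *\<^sub>R v = indicator I x *\<^sub>R (deriv \<phi> x *\<^sub>R v)" for x and v :: 'a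
      using out'[of x] \<open>R > 0\<close> by (cases "\<bar>x\<bar> > R") (auto simp: I_def indicator_def)
    have int1: "integrable lborel (\<lambda>x. deriv \<phi> x *\<^sub>R u x)"
      by (subst \<phi>'_eq, rule borel_integrable_compact)
        (auto simp: I_def intro!: continuous_intros cont_\<phi>' cont_u)
    have int2: "integrable lborel (\<lambda>x. \<phi> x *\<^sub>R u' x)"
      by (subst \<phi>_eq, rule borel_integrable_compact)
        (auto simp: I_def intro!: continuous_intros cont_\<phi> cont_u')
    have "(LINT x|lborel. indicator I x *\<^sub>R (\<phi> x *\<^sub>R u' x + deriv \<phi> x *\<^sub>R u x))
        = \<phi> (R + 1) *\<^sub>R u (R + 1) - \<phi> (- (R + 1)) *\<^sub>R u (- (R + 1))"
      unfolding I_def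
    proof (rule integral_FTC_Icc)
      show "- (R + 1) \<le> R + 1" using \<open>R > 0\<close> by simp
      show "((\<lambda>x. \<phi> x *\<^sub>R u x) has_vector_derivative \<phi> x *\<^sub>R u' x + deriv \<phi> x *\<^sub>R u x)
          (at x within {- (R + 1)..R + 1})" for x
        by (rule has_vector_derivative_at_within, rule has_vector_derivative_scaleR)
          (use D deriv in \<open>auto simp: has_real_derivative_iff_has_vector_derivative\<close>)
      show "continuous_on {- (R + 1)..R + 1} (\<lambda>x. \<phi> x *\<^sub>R u' x + deriv \<phi> x *\<^sub>R u x)"
        by (intro continuous_intros cont_\<phi> cont_\<phi>' cont_u cont_u')
    qed
    also have "\<dots> = 0"
      using out[of "R + 1"] out[of "- (R + 1)"] \<open>R > 0\<close> by auto
    also have "(\<lambda>x. indicator I x *\<^sub>R (\<phi> x *\<^sub>R u' x + deriv \<phi> x *\<^sub>R u x))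
        = (\<lambda>x. \<phi> x *\<^sub>R u' x + deriv \<phi> x *\<^sub>R u x)"
      by (simp only: scaleR_add_right \<phi>_eq[symmetric] \<phi>'_eq[symmetric])
    finally show ?thesis
      using int1 int2 by (simp add: eq_neg_iff_add_eq_0 add.commute)
  qed
  with u u' show ?thesis
    by (simp add: has_L2_weak_derivative_def)
qed

text \<open>Substituting \<open>sqrt (2 * \<alpha>) * x\<close> in a moment of the standard normal
  density gives this function up to a constant.\<close>

lemma integrable_monomial_gaussian:
  fixes \<alpha> :: real
  assumes "\<alpha> > 0"
  shows "integrable lborel (\<lambda>x. x ^ k * exp (- \<alpha> * x\<^sup>2))"
proof -
  define s where "s = sqrt (2 * \<alpha>)"
  have s: "s > 0" "s\<^sup>2 = 2 * \<alpha>"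
    using assms by (auto simp: s_def)
  have "integrable lborel (\<lambda>x. std_normal_density (0 + s * x) * (0 + s * x) ^ k)"
    using s by (intro lborel_integrable_real_affine integrable_std_normal_moment) auto
  then have "integrable lborel
      (\<lambda>x. (sqrt (2 * pi) / s ^ k) * (std_normal_density (0 + s * x) * (0 + s * x) ^ k))"
    by (intro integrable_mult_right)
  also have "(\<lambda>x. (sqrt (2 * pi) / s ^ k) * (std_normal_density (0 + s * x) * (0 + s * x) ^ k))
      = (\<lambda>x. x ^ k * exp (- \<alpha> * x\<^sup>2))"
    using s by (auto simp: std_normal_density_def power_mult_distrib field_simps)
  finally show ?thesis .
qed

lemma square_integrable_add:
  fixes u v :: "real \<Rightarrow> 'a::euclidean_space"
  assumes "square_integrable u" "square_integrable v"
  shows "square_integrable (\<lambda>x. u x + v x)"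
proof -
  have meas: "u \<in> borel_measurable borel" "v \<in> borel_measurable borel"
    using assms by (auto simp: square_integrable_def)
  have int: "integrable lborel (\<lambda>x. 2 * (norm (u x))\<^sup>2 + 2 * (norm (v x))\<^sup>2)"
    using assms by (auto simp: square_integrable_def)
  have "(norm (u x + v x))\<^sup>2 \<le> 2 * (norm (u x))\<^sup>2 + 2 * (norm (v x))\<^sup>2" for x
  proof -
    have "(norm (u x + v x))\<^sup>2 \<le> (norm (u x) + norm (v x))\<^sup>2"
      by (intro power_mono norm_triangle_ineq) auto
    also have "\<dots> \<le> 2 * (norm (u x))\<^sup>2 + 2 * (norm (v x))\<^sup>2"
      using zero_le_power2[of "norm (u x) - norm (v x)"] by (simp add: power2_eq_square algebra_simps)
    finally show ?thesis .
  qed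
  then have "integrable lborel (\<lambda>x. (norm (u x + v x))\<^sup>2)"
    using meas by (intro Bochner_Integration.integrable_bound[OF int]) auto
  then show ?thesis
    using meas by (simp add: square_integrable_def)
qed

section \<open>Scalar Gaussian waves\<close>

text \<open>A coherent state with centre \<open>c\<close>, frequency \<open>\<eta>\<close> and
  complex width \<open>a\<close>. The polynomial factor makes the family closed under
  differentiation and multiplication by \<open>x\<close>, so that differential operators reduce to
  polynomial algebra.\<close>

definition gaussian_wave :: "complex \<Rightarrow> real \<Rightarrow> real \<Rightarrow> complex poly \<Rightarrow> real \<Rightarrow> complex" where
  "gaussian_wave a \<eta> c p x =
     poly p (of_real (x - c)) * exp (- a / 2 * (of_real (x - c))\<^sup>2 + \<i> * of_real \<eta> * of_real (x - c))"

lemma gaussian_wave_add: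
  "gaussian_wave a \<eta> c (p + q) x = gaussian_wave a \<eta> c p x + gaussian_wave a \<eta> c q x"
  by (simp add: gaussian_wave_def algebra_simps)

lemma norm_gaussian_wave:
  "norm (gaussian_wave a \<eta> c p x) =
     norm (poly p (of_real (x - c))) * exp (- Re a / 2 * (x - c)\<^sup>2)"
proof -
  have "- a / 2 * (of_real (x - c))\<^sup>2 + \<i> * of_real \<eta> * of_real (x - c)
      = of_real ((x - c)\<^sup>2) * (- a / 2) + of_real (\<eta> * (x - c)) * \<i>"
    by simp
  then have "Re (- a / 2 * (of_real (x - c))\<^sup>2 + \<i> * of_real \<eta> * of_real (x - c))
      = - Re a / 2 * (x - c)\<^sup>2"
    by (simp only: plus_complex.sel Re_complex_of_real Im_complex_of_real times_complex.sel) simp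
  then show ?thesis
    by (simp only: gaussian_wave_def norm_mult norm_exp_eq_Re)
qed

lemma gaussian_wave_has_vector_derivative:
  "(gaussian_wave a \<eta> c p has_vector_derivative
     gaussian_wave a \<eta> c (pderiv p + [:\<i> * of_real \<eta>, - a:] * p) x) (at x)"
proof -
  \<comment> \<open>The wave is the restriction of an entire function, whose complex derivative
    gives the derivative along the real line.\<close>
  let ?g = "\<lambda>w. poly p (w - of_real c) *
      exp (- a / 2 * (w - of_real c)\<^sup>2 + \<i> * of_real \<eta> * (w - of_real c))"
  have "(?g has_field_derivative gaussian_wave a \<eta> c (pderiv p + [:\<i> * of_real \<eta>, - a:] * p) x)
      (at (of_real x))"
    unfolding gaussian_wave_def
    by (rule derivative_eq_intros DERIV_chain2[OF poly_DERIV] refl)+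
      (simp add: algebra_simps)
  from has_vector_derivative_real_field[OF this] show ?thesis
    by (simp add: gaussian_wave_def[abs_def])
qed

lemma continuous_on_gaussian_wave: "continuous_on A (gaussian_wave a \<eta> c p)"
  using gaussian_wave_has_vector_derivative has_vector_derivative_continuous
  by (blast intro: continuous_at_imp_continuous_on)

lemma square_integrable_gaussian_monomial:
  assumes "Re a > 0"
  shows "square_integrable (gaussian_wave a \<eta> c (monom b k))"
proof -
  have "integrable lborel (\<lambda>x. (norm b)\<^sup>2 * ((- c + 1 * x) ^ (2 * k) * exp (- Re a * (- c + 1 * x)\<^sup>2)))"
    using assms
    by (intro integrable_mult_right lborel_integrable_real_affine[of "\<lambda>x. x ^ (2 * k) * exp (- Re a * x\<^sup>2)"]
        integrable_monomial_gaussian) auto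
  also have "(\<lambda>x. (norm b)\<^sup>2 * ((- c + 1 * x) ^ (2 * k) * exp (- Re a * (- c + 1 * x)\<^sup>2)))
      = (\<lambda>x. (norm (gaussian_wave a \<eta> c (monom b k) x))\<^sup>2)"
  proof
    fix x
    have "exp (- Re a * (x - c)\<^sup>2) = (exp (- Re a / 2 * (x - c)\<^sup>2))\<^sup>2"
      by (simp add: exp_double[symmetric])
    moreover have "\<bar>x - c\<bar> ^ (2 * k) = (x - c) ^ (2 * k)"
      by (simp add: power_even_abs)
    ultimately show "(norm b)\<^sup>2 * ((- c + 1 * x) ^ (2 * k) * exp (- Re a * (- c + 1 * x)\<^sup>2))
        = (norm (gaussian_wave a \<eta> c (monom b k) x))\<^sup>2"
      by (simp add: norm_gaussian_wave poly_monom norm_mult norm_power power_mult_distrib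
          power_mult[symmetric] mult.commute[of k] del: of_real_diff)
  qed
  finally show ?thesis
    using borel_measurable_continuous_onI[OF continuous_on_gaussian_wave]
    by (simp add: square_integrable_def)
qed

lemma square_integrable_gaussian_wave:
  assumes "Re a > 0"
  shows "square_integrable (gaussian_wave a \<eta> c p)"
proof -
  \<comment> \<open>Splitting off the constant coefficient of \<open>pCons b p\<close> leaves
    \<open>p\<close> times the variable; the extra monomial factor lets the induction absorb
    it.\<close>
  have "square_integrable (gaussian_wave a \<eta> c (monom 1 k * p))" for k
  proof (induction p arbitrary: k)
    case 0
    show ?case
      using square_integrable_gaussian_monomial[OF assms, of \<eta> c 0 0] by simp
  next
    case (pCons b p)
    have "monom 1 k * pCons b p = monom b k + monom 1 (Suc k) * p"
      by (simp add: monom_altdef algebra_simps smult_monom)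
    then show ?case
      using square_integrable_add[OF square_integrable_gaussian_monomial[OF assms] pCons.IH]
      by (simp add: gaussian_wave_add[abs_def])
  qed
  from this[of 0] show ?thesis by simp
qed

lemma gaussian_wave_times_argument:
  "gaussian_wave a \<eta> c ([:of_real c, 1:] * p) x = of_real x * gaussian_wave a \<eta> c p x"
  by (simp add: gaussian_wave_def algebra_simps)

text \<open>The modulus does not depend on the real frequency, and Lebesgue measure is translation
  invariant. Hence moving the centre and the frequency with \<open>r\<close> leaves all norms
  fixed.\<close>

lemma L2_norm_gaussian_wave:
  "L2_norm (gaussian_wave a \<eta> c p) = L2_norm (gaussian_wave a 0 0 p)"
proof -
  have "(LINT x|lborel. (norm (gaussian_wave a \<eta> c p x))\<^sup>2)
      = \<bar>1\<bar> *\<^sub>R (LINT x|lborel. (norm (gaussian_wave a \<eta> c p (c + 1 * x)))\<^sup>2)"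
    by (rule lborel_integral_real_affine) simp
  then show ?thesis
    by (simp add: L2_norm_def norm_gaussian_wave)
qed

lemma L2_norm_gaussian_wave_smult:
  "L2_norm (gaussian_wave a \<eta> c (smult k p)) = norm k * L2_norm (gaussian_wave a \<eta> c p)"
  by (simp add: L2_norm_def gaussian_wave_def norm_mult power_mult_distrib mult.assoc real_sqrt_mult)

lemma L2_norm_gaussian_wave_pos:
  assumes "Re a > 0"
  shows "L2_norm (gaussian_wave a \<eta> c 1) > 0"
proof -
  have "(LINT x|lborel. (norm (gaussian_wave a \<eta> c 1 x))\<^sup>2) > 0"
  proof (rule ccontr)
    assume "\<not> ?thesis"
    moreover have "(LINT x|lborel. (norm (gaussian_wave a \<eta> c 1 x))\<^sup>2) \<ge> 0"
      by simp
    ultimately have "(LINT x|lborel. (norm (gaussian_wave a \<eta> c 1 x))\<^sup>2) = 0"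
      by linarith
    then have "AE x in lborel. (norm (gaussian_wave a \<eta> c 1 x))\<^sup>2 = 0"
      using square_integrable_gaussian_wave[OF assms, of \<eta> c 1]
      by (subst (asm) integral_nonneg_eq_0_iff_AE) (auto simp: square_integrable_def)
    \<comment> \<open>The wave with polynomial \<open>1\<close> has no zeros, so vanishing almost
      everywhere would make Lebesgue measure trivial.\<close>
    then have "ae_filter (lborel :: real measure) = bot"
      by (simp add: gaussian_wave_def eventually_False)
    then show False
      by (simp add: ae_filter_eq_bot_iff)
  qed
  then show ?thesis
    by (simp add: L2_norm_def)
qed

section \<open>Vector-valued Gaussian waves and the operator domain\<close>

definition gaussian_field ::
    "complex \<Rightarrow> real \<Rightarrow> real \<Rightarrow> ('n \<Rightarrow> complex poly) \<Rightarrow> real \<Rightarrow> complex^'n" where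
  "gaussian_field a \<eta> c p x = (\<chi> i. gaussian_wave a \<eta> c (p i) x)"

lemma gaussian_field_has_vector_derivative:
  fixes p :: "'n::finite \<Rightarrow> complex poly"
  shows "(gaussian_field a \<eta> c p has_vector_derivative
     gaussian_field a \<eta> c (\<lambda>i. pderiv (p i) + [:\<i> * of_real \<eta>, - a:] * p i) x) (at x)"
  unfolding has_vector_derivative_def
proof (subst has_derivative_componentwise_within, rule ballI)
  fix b :: "complex^'n" assume "b \<in> Basis"
  then obtain i w where b: "b = axis i w"
    by (auto simp: Basis_vec_def)
  show "((\<lambda>x. gaussian_field a \<eta> c p x \<bullet> b) has_derivative (\<lambda>h. (h *\<^sub>R
      gaussian_field a \<eta> c (\<lambda>i. pderiv (p i) + [:\<i> * of_real \<eta>, - a:] * p i) x) \<bullet> b)) (at x)"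
    using has_derivative_inner_left[OF gaussian_wave_has_vector_derivative[of a \<eta> c "p i" x,
          unfolded has_vector_derivative_def], of w]
    by (simp add: b inner_axis gaussian_field_def)
qed

lemma continuous_on_gaussian_field:
  fixes p :: "'n::finite \<Rightarrow> complex poly"
  shows "continuous_on A (gaussian_field a \<eta> c p)"
  using gaussian_field_has_vector_derivative has_vector_derivative_continuous
  by (blast intro: continuous_at_imp_continuous_on)

lemma power2_norm_gaussian_field:
  fixes p :: "'n::finite \<Rightarrow> complex poly"
  shows "(norm (gaussian_field a \<eta> c p x))\<^sup>2 = (\<Sum>i\<in>UNIV. (norm (gaussian_wave a \<eta> c (p i) x))\<^sup>2)"
  by (simp add: norm_vec_def L2_set_def gaussian_field_def sum_nonneg)

lemma square_integrable_gaussian_field: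
  fixes p :: "'n::finite \<Rightarrow> complex poly"
  assumes "Re a > 0"
  shows "square_integrable (gaussian_field a \<eta> c p)"
  using square_integrable_gaussian_wave[OF assms]
    borel_measurable_continuous_onI[OF continuous_on_gaussian_field[of UNIV a \<eta> c p]]
  by (simp add: square_integrable_def power2_norm_gaussian_field)

lemma power2_L2_norm_gaussian_field:
  fixes p :: "'n::finite \<Rightarrow> complex poly"
  assumes "Re a > 0"
  shows "(L2_norm (gaussian_field a \<eta> c p))\<^sup>2 = (\<Sum>i\<in>UNIV. (L2_norm (gaussian_wave a \<eta> c (p i)))\<^sup>2)"
  using square_integrable_gaussian_wave[OF assms]
  by (simp add: L2_norm_def power2_norm_gaussian_field square_integrable_def sum_nonneg)

text \<open>The weight costs nothing: \<open>x\<close> times a Gaussian wave is the Gaussian wave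
  whose polynomial gains the factor \<open>[:of_real c, 1:]\<close>.\<close>

lemma gaussian_field_in_H_domain:
  assumes "Re a > 0"
  shows "gaussian_field a \<eta> c p \<in> H_domain"
proof -
  have "gaussian_wave a \<eta> c q \<in> sobolev_H1" for q
    unfolding sobolev_H1_def
    using has_L2_weak_derivative_of_C1[OF square_integrable_gaussian_wave square_integrable_gaussian_wave
        gaussian_wave_has_vector_derivative continuous_on_gaussian_wave] assms by blast
  moreover have "gaussian_wave a \<eta> c q \<in> weighted_L2" for q
  proof -
    have "(norm (gaussian_wave a \<eta> c ([:of_real c, 1:] * q) x))\<^sup>2
        = (norm (gaussian_wave a \<eta> c q x))\<^sup>2 * x\<^sup>2" for x
      by (simp only: gaussian_wave_times_argument norm_mult power_mult_distrib)
        (simp add: power2_eq_square)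
    then show ?thesis
      using square_integrable_gaussian_wave[OF assms, of \<eta> c "[:of_real c, 1:] * q"]
        square_integrable_gaussian_wave[OF assms, of \<eta> c q]
      by (simp only: weighted_L2_def square_integrable_def mem_Collect_eq)
  qed
  ultimately show ?thesis
    by (simp add: H_domain_def gaussian_field_def)
qed

section \<open>Action of the operator on Gaussian spinors\<close>

lemma vector_4:
  "(vector [w, x, y, z] :: 'a::zero^4) $ 1 = w"
  "(vector [w, x, y, z] :: 'a::zero^4) $ 2 = x"
  "(vector [w, x, y, z] :: 'a::zero^4) $ 3 = y"
  "(vector [w, x, y, z] :: 'a::zero^4) $ 4 = z"
  unfolding vector_def by simp_all

text \<open>This is \<open>(v, v)\<close> with \<open>v = (p, q)\<close>. Antidiagonal blocks swap
  the two halves, so such spinors are preserved and each Dirac matrix acts on \<open>v\<close> as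
  its Pauli matrix.\<close>

definition spinor :: "'a \<Rightarrow> 'a \<Rightarrow> 4 \<Rightarrow> 'a" where
  "spinor p q i = (if i = 1 \<or> i = 3 then p else q)"

text \<open>
  With \<open>g\<close> the Gaussian wave of polynomial \<open>1\<close>, this is the polynomial factor, in the variable
  \<open>x - c\<close>, of \<open>(A' A + m\<^sup>2 - z\<^sup>2) g\<close>.
\<close>

definition quasimode_residual ::
    "real \<Rightarrow> real \<Rightarrow> complex \<Rightarrow> complex \<Rightarrow> real \<Rightarrow> real \<Rightarrow> complex poly" where
  "quasimode_residual m \<theta> z a \<eta> c =
     [:(of_real m)\<^sup>2 - z\<^sup>2 + (of_real \<eta>)\<^sup>2 / cis \<theta> + a / cis \<theta> - 1 + cis \<theta> * (of_real c)\<^sup>2,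
       2 * \<i> * a * of_real \<eta> / cis \<theta> + 2 * cis \<theta> * of_real c, cis \<theta> - a\<^sup>2 / cis \<theta>:]"

text \<open>The first field is \<open>(D + z) (t g, 0)\<close>, the second
  \<open>(D - z) (D + z) (t g, 0)\<close>, for the Gaussian wave \<open>g\<close> of polynomial
  \<open>1\<close>. The factor \<open>t\<close> is left free for normalisation.\<close>

lemma gaussian_field_in_H_op:
  assumes "Re a > 0"
  shows "\<exists>p. (gaussian_field a \<eta> c (spinor [:t * (z + of_real m):] p),
       gaussian_field a \<eta> c (spinor (smult t (quasimode_residual m \<theta> z a \<eta> c)) 0))
     \<in> subtract_scalar (H_op m \<theta>) z"
proof -
  define e where "e = exp (\<i> * of_real \<theta> / 2)"
  have e2: "cis \<theta> = e\<^sup>2"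
    by (simp add: e_def exp_double[symmetric] cis_conv_exp)
  \<comment> \<open>The second entry is the polynomial factor of \<open>- \<i> A (t g)\<close>,
    computed from \<open>g' = (\<i> \<eta> - a (x - c)) g\<close>.\<close>
  define p where "p = spinor [:t * (z + of_real m):]
            [:- \<i> * t * (\<i> * of_real \<eta> / e + e * of_real c), - \<i> * t * (e - a / e):]"
  define q where "q = spinor (smult t (quasimode_residual m \<theta> z a \<eta> c)) 0"
  define p' where "p' = (\<lambda>i. pderiv (p i) + [:\<i> * of_real \<eta>, - a:] * p i)"
  define f where "f x = gaussian_field a \<eta> c q x + z *s gaussian_field a \<eta> c p x" for x
  have e: "e \<noteq> 0" "exp (- \<i> * of_real \<theta> / 2) = 1 / e"
    by (auto simp: e_def exp_minus field_simps)
  have "f = gaussian_field a \<eta> c (\<lambda>i. q i + smult z (p i))"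
    by (auto simp: f_def gaussian_field_def gaussian_wave_def vec_eq_iff algebra_simps)
  then have f: "square_integrable f"
    by (simp add: square_integrable_gaussian_field assms)
  have weak: "has_L2_weak_derivative (gaussian_field a \<eta> c p) (gaussian_field a \<eta> c p')"
    unfolding p'_def
    by (intro has_L2_weak_derivative_of_C1 square_integrable_gaussian_field
        gaussian_field_has_vector_derivative continuous_on_gaussian_field assms)
  have "f x = (- \<i> * (1 / e)) *s (dirac1 *v gaussian_field a \<eta> c p' x)
          - (e * of_real x) *s (dirac2 *v gaussian_field a \<eta> c p x)
          + of_real m *s (dirac3 *v gaussian_field a \<eta> c p x)" for x
  proof -
    define y where "y = complex_of_real (x - c)"
    define E where "E = exp (- a / 2 * y\<^sup>2 + \<i> * of_real \<eta> * y)"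
    have x: "complex_of_real x = y + of_real c"
      by (simp add: y_def)
    have comp: "gaussian_field a \<eta> c r x $ i = poly (r i) y * E" for r :: "4 \<Rightarrow> complex poly" and i
      by (simp add: gaussian_field_def gaussian_wave_def y_def E_def)
    show ?thesis
      unfolding vec_eq_iff forall_4 f_def vector_add_component vector_minus_component
        vector_smult_component dirac1_def dirac2_def dirac3_def
        antidiag_block_def pauli1_def pauli2_def pauli3_def
      using e(1)
      by (simp add: matrix_vector_mult_def sum_4 vector_4 comp x p'_def p_def q_def spinor_def quasimode_residual_def e2
          pderiv_pCons field_simps power2_eq_square)
  qed
  then have "(gaussian_field a \<eta> c p, f) \<in> H_op m \<theta>"
    unfolding H_op_def e(2) e_def[symmetric]
    using gaussian_field_in_H_domain[OF assms, of \<eta> c p] f weak by auto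
  moreover have "gaussian_field a \<eta> c q = (\<lambda>x. f x - z *s gaussian_field a \<eta> c p x)"
    by (simp add: f_def)
  ultimately show ?thesis
    unfolding p_def q_def subtract_scalar_def by blast
qed

section \<open>Parameters that make the residual independent of \<open>r\<close>\<close>

text \<open>
  The point \<open>(X, - K)\<close> of phase space is where the symbol takes the value \<open>exp (2 i \<phi>)\<close>; the condition
  \<open>2 \<bar>\<phi>\<bar> < \<theta>\<close> makes it real.
\<close>

lemma symbol_parameters:
  fixes \<theta> \<phi> :: real
  assumes "0 < \<theta>" "\<theta> < pi / 2" "\<phi> \<in> {- \<theta> / 2 <..< \<theta> / 2}"
  obtains X K :: real where "X > 0" "K > 0"
    "(of_real K)\<^sup>2 / cis \<theta> + cis \<theta> * (of_real X)\<^sup>2 = (cis \<phi>)\<^sup>2"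
proof -
  have s: "sin \<theta> > 0" "cos \<theta> > 0" "sin (2 * \<theta>) > 0" "sin (\<theta> + 2 * \<phi>) > 0" "sin (\<theta> - 2 * \<phi>) > 0"
    using assms by (auto intro!: sin_gt_zero cos_gt_zero)
  \<comment> \<open>Real and imaginary parts of the symbol equation form a linear system for
    \<open>X\<^sup>2\<close> and \<open>K\<^sup>2\<close> of determinant
    \<open>sin (2 * \<theta>)\<close>; these are the roots of its solution by Cramer's rule.\<close>
  define X where "X = sqrt (sin (\<theta> + 2 * \<phi>) / sin (2 * \<theta>))"
  define K where "K = sqrt (sin (\<theta> - 2 * \<phi>) / sin (2 * \<theta>))"
  have X2: "X\<^sup>2 = sin (\<theta> + 2 * \<phi>) / sin (2 * \<theta>)" and K2: "K\<^sup>2 = sin (\<theta> - 2 * \<phi>) / sin (2 * \<theta>)"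
    using s by (auto simp: X_def K_def)
  have re: "cos \<theta> * K\<^sup>2 + cos \<theta> * X\<^sup>2 = cos (2 * \<phi>)"
    using s(1,2) unfolding X2 K2 sin_add sin_diff sin_double[of \<theta>] by (simp add: field_simps)
  have im: "- sin \<theta> * K\<^sup>2 + sin \<theta> * X\<^sup>2 = sin (2 * \<phi>)"
    using s(1,2) unfolding X2 K2 sin_add sin_diff sin_double[of \<theta>] by (simp add: field_simps)
  have "(of_real K)\<^sup>2 / cis \<theta> + cis \<theta> * (of_real X)\<^sup>2
      = cis (- \<theta>) * of_real (K\<^sup>2) + cis \<theta> * of_real (X\<^sup>2)"
    by (simp add: divide_inverse mult.commute cis_inverse)
  also have "\<dots> = cis (2 * \<phi>)"
    using re im by (intro complex_eqI) (simp_all del: of_real_power)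
  also have "\<dots> = (cis \<phi>)\<^sup>2"
    by (simp add: Complex.DeMoivre)
  finally show thesis
    using that[of X K] s by (simp add: X_def K_def)
qed

text \<open>Only centre and frequency move with \<open>r\<close>; the width \<open>a\<close> and the
  residual \<open>q\<close> are fixed, which gives uniform bounds. The shift \<open>\<delta>\<close>
  makes room for the offsets \<open>m\<close> and \<open>- m\<close> of the spectral
  parameter.\<close>

lemma quasimode_parameters:
  fixes m \<theta> \<phi> :: real and \<delta> :: complex
  assumes "0 < \<theta>" "\<theta> < pi / 2" "\<phi> \<in> {- \<theta> / 2 <..< \<theta> / 2}"
  obtains a q where "Re a > 0"
    "\<And>r::real. \<exists>\<eta> c. quasimode_residual m \<theta> (cis \<phi> * (of_real r + \<delta>)) a \<eta> c = q"
proof -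
  define E where "E = cis \<theta>"
  define F where "F = cis \<phi>"
  obtain X K :: real where XK: "X > 0" "K > 0"
      and symbol: "(of_real K)\<^sup>2 / E + E * (of_real X)\<^sup>2 = F\<^sup>2"
    using symbol_parameters[OF assms] unfolding E_def F_def by metis
  \<comment> \<open>This width cancels the term of the residual that is linear in both \<open>r\<close> and \<open>x - c\<close>; positivity of its
    real part is what selects the sign of the momentum \<open>- K r\<close>.\<close>
  define a where "a = - \<i> * E\<^sup>2 * of_real (X / K)"
  have "Re a = sin (2 * \<theta>) * (X / K)"
    unfolding a_def E_def Complex.DeMoivre by simp
  moreover have "sin (2 * \<theta>) > 0"
    using assms by (intro sin_gt_zero) auto
  ultimately have a: "Re a > 0"
    using XK by simp
  \<comment> \<open>The centre and the frequency are \<open>r X + \<kappa>\<close> and \<open>- K r + \<eta>0\<close>; the constants \<open>\<kappa>\<close>, \<open>\<eta>0\<close> absorb the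
    contribution of order \<open>r\<close> that the shift \<open>\<delta>\<close> makes to \<open>z\<^sup>2\<close>.\<close>
  define \<beta> where "\<beta> = \<delta> * (a * of_real X - \<i> * of_real K)"
  \<comment> \<open>Cancellation at order \<open>r\<close> amounts to
    \<open>\<i> \<eta>0 + a \<kappa> = \<beta>\<close> with real unknowns. Since
    \<open>Re a > 0\<close>, the real part determines \<open>\<kappa>\<close>, and then the
    imaginary part determines \<open>\<eta>0\<close>.\<close>
  define \<kappa> where "\<kappa> = Re \<beta> / Re a"
  define \<eta>0 where "\<eta>0 = Im (\<beta> - a * of_real \<kappa>)"
  have "\<i> * of_real \<eta>0 = \<beta> - a * of_real \<kappa>"
    using a by (auto simp: complex_eq_iff \<eta>0_def \<kappa>_def)
  then have eta0: "\<i> * of_real \<eta>0 = \<delta> * (a * of_real X - \<i> * of_real K) - a * of_real \<kappa>"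
    by (simp add: \<beta>_def)
  have aK: "a * of_real K = - \<i> * E\<^sup>2 * of_real X"
    using XK by (simp add: a_def)
  define I where "I = 1 / E"
  have I: "E * I = 1" and div: "w / E = w * I" for w
    by (auto simp: I_def E_def)
  have aKI: "a * of_real K * I = - \<i> * E * of_real X"
    using I unfolding aK by (simp add: power2_eq_square)
  \<comment> \<open>The terms in \<open>r\<^sup>2\<close> cancel by the symbol equation, those in
    \<open>r\<close> by the choice of \<open>\<kappa>\<close> and \<open>\<eta>0\<close>.\<close>
  have const: "- (F * (of_real r + \<delta>))\<^sup>2 + (of_real (- K * r + \<eta>0))\<^sup>2 * I + E * (of_real (r * X + \<kappa>))\<^sup>2
      = - (F * \<delta>)\<^sup>2 + (of_real \<eta>0)\<^sup>2 * I + E * (of_real \<kappa>)\<^sup>2" for r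
  proof -
    have \<eta>0: "of_real \<eta>0 = - \<i> * (\<delta> * (a * of_real X - \<i> * of_real K) - a * of_real \<kappa>)"
      unfolding eta0[symmetric] by simp
    have "of_real K * of_real \<eta>0 * I
        = - \<i> * (\<delta> * ((a * of_real K * I) * of_real X - \<i> * (of_real K)\<^sup>2 * I)
            - (a * of_real K * I) * of_real \<kappa>)"
      unfolding \<eta>0 by (simp add: algebra_simps power2_eq_square)
    also have "\<dots> = - \<delta> * F\<^sup>2 + E * of_real X * of_real \<kappa>"
      unfolding aKI symbol[symmetric] div by (simp add: algebra_simps power2_eq_square)
    finally have K\<eta>: "of_real K * of_real \<eta>0 * I = - \<delta> * F\<^sup>2 + E * of_real X * of_real \<kappa>" .
    have "(F * (of_real r + \<delta>))\<^sup>2 = (F * \<delta>)\<^sup>2 + F\<^sup>2 * (of_real r)\<^sup>2 + 2 * of_real r * (\<delta> * F\<^sup>2)"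
      by (simp add: algebra_simps power2_eq_square)
    moreover have "(of_real (- K * r + \<eta>0))\<^sup>2 * I
        = (of_real \<eta>0)\<^sup>2 * I + (of_real r)\<^sup>2 * ((of_real K)\<^sup>2 * I)
          - 2 * of_real r * (of_real K * of_real \<eta>0 * I)"
      by (simp add: algebra_simps power2_eq_square)
    moreover have "E * (of_real (r * X + \<kappa>))\<^sup>2
        = E * (of_real \<kappa>)\<^sup>2 + (of_real r)\<^sup>2 * (E * (of_real X)\<^sup>2)
          + 2 * of_real r * (E * of_real X * of_real \<kappa>)"
      by (simp add: algebra_simps power2_eq_square)
    ultimately show ?thesis
      unfolding K\<eta> symbol[symmetric] div by (simp add: algebra_simps)
  qed
  have lin: "2 * \<i> * a * of_real (- K * r + \<eta>0) * I + 2 * E * of_real (r * X + \<kappa>)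
      = 2 * \<i> * a * of_real \<eta>0 * I + 2 * E * of_real \<kappa>" for r
  proof -
    have "2 * \<i> * a * of_real (- K * r + \<eta>0) * I
        = 2 * \<i> * a * of_real \<eta>0 * I - 2 * \<i> * of_real r * (a * of_real K * I)"
      by (simp add: algebra_simps)
    then show ?thesis
      unfolding aKI by (simp add: algebra_simps)
  qed
  show thesis
  proof (rule that[OF a], intro exI)
    fix r :: real
    show "quasimode_residual m \<theta> (cis \<phi> * (of_real r + \<delta>)) a (- K * r + \<eta>0) (r * X + \<kappa>)
      = [:(of_real m)\<^sup>2 - (F * \<delta>)\<^sup>2 + (of_real \<eta>0)\<^sup>2 * I + a * I - 1 + E * (of_real \<kappa>)\<^sup>2,
        2 * \<i> * a * of_real \<eta>0 * I + 2 * E * of_real \<kappa>, E - a\<^sup>2 * I:]"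
      unfolding quasimode_residual_def E_def[symmetric] F_def[symmetric] div lin
      using const[of r] by (simp add: algebra_simps del: of_real_add of_real_mult)
  qed
qed

section \<open>Growth of the resolvent norm along rays\<close>

text \<open>One scaling \<open>t\<close> puts the residual into the unit ball for every
  \<open>r\<close>, while a single component of the quasimode already has norm
  \<open>t * N * norm (z + of_real m)\<close>.\<close>

lemma operator_norm_resolvent_lower_bound:
  fixes m \<theta> \<phi> :: real and \<delta> :: complex
  assumes "0 < \<theta>" "\<theta> < pi / 2" "\<phi> \<in> {- \<theta> / 2 <..< \<theta> / 2}"
  obtains B where "B > 0"
    "\<And>r::real. operator_norm (resolvent (H_op m \<theta>) (cis \<phi> * (of_real r + \<delta>)))
       \<ge> ennreal (B * norm (cis \<phi> * (of_real r + \<delta>) + of_real m))"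
proof -
  obtain a q where a: "Re a > 0"
      and q: "\<And>r::real. \<exists>\<eta> c. quasimode_residual m \<theta> (cis \<phi> * (of_real r + \<delta>)) a \<eta> c = q"
    using quasimode_parameters[OF assms, where m = m and \<delta> = \<delta>] by metis
  define N where "N = L2_norm (gaussian_wave a 0 0 1)"
  define Q where "Q = L2_norm (gaussian_wave a 0 0 q)"
  \<comment> \<open>The residual field has two nonzero slots, so its norm is
    \<open>sqrt 2 * t * Q\<close>, at most \<open>2 * t * Q \<le> 1\<close>. The summand
    \<open>1\<close> covers \<open>Q = 0\<close>.\<close>
  define t where "t = 1 / (1 + 2 * Q)"
  have N: "N > 0"
    unfolding N_def by (rule L2_norm_gaussian_wave_pos[OF a])
  have Q: "Q \<ge> 0"
    by (simp add: Q_def L2_norm_def)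
  then have t: "t > 0" "2 * (t * Q) \<le> 1"
    by (auto simp: t_def field_simps)
  have "ennreal (t * N * norm (cis \<phi> * (of_real r + \<delta>) + of_real m))
      \<le> operator_norm (resolvent (H_op m \<theta>) (cis \<phi> * (of_real r + \<delta>)))" for r :: real
  proof -
    define z where "z = cis \<phi> * (of_real r + \<delta>)"
    obtain \<eta> c where q': "quasimode_residual m \<theta> z a \<eta> c = q"
      using q[of r] unfolding z_def by blast
    obtain p where mem: "(gaussian_field a \<eta> c (spinor [:of_real t * (z + of_real m):] p),
        gaussian_field a \<eta> c (spinor (smult (of_real t) q) 0)) \<in> subtract_scalar (H_op m \<theta>) z"
      using gaussian_field_in_H_op[OF a, of \<eta> c "of_real t" z m \<theta>] unfolding q' by blast
    let ?u = "gaussian_field a \<eta> c (spinor [:of_real t * (z + of_real m):] p)"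
    let ?f = "gaussian_field a \<eta> c (spinor (smult (of_real t) q) 0)"
    \<comment> \<open>The instance with scalar and polynomial \<open>0\<close> shows that the zero
      components have norm \<open>0\<close>.\<close>
    have "(L2_norm ?f)\<^sup>2 = 2 * (t * Q)\<^sup>2"
      using t L2_norm_gaussian_wave_smult[of a 0 0 0 0]
      by (simp add: power2_L2_norm_gaussian_field[OF a] sum_4 spinor_def L2_norm_gaussian_wave_smult
          L2_norm_gaussian_wave[of a \<eta> c] Q_def)
    also have "\<dots> \<le> (2 * (t * Q))\<^sup>2"
      unfolding power_mult_distrib[of 2] by simp
    also have "\<dots> \<le> 1\<^sup>2"
      using t Q by (intro power_mono) auto
    finally have "L2_norm ?f \<le> 1"
      by (rule power2_le_imp_le) simp
    moreover have "(?f, ?u) \<in> resolvent (H_op m \<theta>) z"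
      using mem by (simp add: resolvent_def)
    ultimately have "ennreal (L2_norm ?u) \<le> operator_norm (resolvent (H_op m \<theta>) z)"
      unfolding operator_norm_def by (intro SUP_upper2[of "(?f, ?u)"]) auto
    moreover have "t * N * norm (z + of_real m) \<le> L2_norm ?u"
    proof -
      have "[:of_real t * (z + of_real m):] = smult (of_real t * (z + of_real m)) 1"
        by simp
      then have "L2_norm (gaussian_wave a \<eta> c [:of_real t * (z + of_real m):]) = t * N * norm (z + of_real m)"
        using t by (simp only: L2_norm_gaussian_wave_smult L2_norm_gaussian_wave[of a \<eta> c])
          (simp add: N_def norm_mult)
      then have "(t * N * norm (z + of_real m))\<^sup>2 \<le> (L2_norm ?u)\<^sup>2"
        by (simp add: power2_L2_norm_gaussian_field[OF a] sum_4 spinor_def)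
      then show ?thesis
        by (rule power2_le_imp_le) (simp add: L2_norm_def)
    qed
    ultimately show ?thesis
      unfolding z_def by (meson ennreal_leI order_trans)
  qed
  then show thesis
    using that[of "t * N"] t N by simp
qed

text \<open>Reverse triangle inequality. Assuming only that \<open>\<bar>r\<bar>\<close> diverges
  along \<open>F\<close> covers both ends of the line.\<close>

lemma tendsto_norm_cis_ray:
  fixes w v :: complex
  assumes "filterlim (\<lambda>r::real. \<bar>r\<bar>) at_top F" and "B > 0"
  shows "filterlim (\<lambda>r. B * norm (cis \<phi> * (of_real r + w) + v)) at_top F"
proof -
  have "filterlim (\<lambda>r. - (norm w + norm v) + \<bar>r\<bar>) at_top F"
    by (rule filterlim_tendsto_add_at_top[OF tendsto_const assms(1)])
  moreover have "\<forall>r. - (norm w + norm v) + \<bar>r\<bar> \<le> norm (cis \<phi> * (of_real r + w) + v)"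
  proof
    fix r :: real
    have "\<bar>r\<bar> = norm (cis \<phi> * of_real r)"
      by (simp add: norm_mult)
    also have "cis \<phi> * of_real r = (cis \<phi> * (of_real r + w) + v) - (cis \<phi> * w + v)"
      by (simp add: algebra_simps)
    also have "norm \<dots> \<le> norm (cis \<phi> * (of_real r + w) + v) + norm (cis \<phi> * w + v)"
      by (rule norm_triangle_ineq4)
    also have "norm (cis \<phi> * w + v) \<le> norm w + norm v"
      using norm_triangle_ineq[of "cis \<phi> * w" v] by (simp add: norm_mult)
    finally show "- (norm w + norm v) + \<bar>r\<bar> \<le> norm (cis \<phi> * (of_real r + w) + v)"
      by simp
  qed
  ultimately have "filterlim (\<lambda>r. norm (cis \<phi> * (of_real r + w) + v)) at_top F"
    by (auto intro: filterlim_at_top_mono always_eventually)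
  then show ?thesis
    using assms(2) by (intro filterlim_tendsto_pos_mult_at_top[OF tendsto_const])
qed

theorem mainTheorem6:
  fixes m \<theta> :: real
  assumes "m \<ge> 0" and "\<theta> \<in> {- pi / 2 <..< pi / 2}"
  shows "\<forall>\<phi> \<in> {- \<theta> / 2 <..< \<theta> / 2} - {0}.
    ((\<lambda>r::real. operator_norm
        (resolvent (H_op m \<theta>) (of_real m + of_real r * exp (\<i> * of_real \<phi>))))
      \<longlongrightarrow> \<infinity>) at_top \<and>
    ((\<lambda>r::real. operator_norm
        (resolvent (H_op m \<theta>) (- of_real m + of_real r * exp (\<i> * of_real \<phi>))))
      \<longlongrightarrow> \<infinity>) at_bot"
proof
  fix \<phi> assume \<phi>: "\<phi> \<in> {- \<theta> / 2 <..< \<theta> / 2} - {0}"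
  \<comment> \<open>A point in the interval forces \<open>\<theta>\<close> to be positive.\<close>
  then have \<theta>: "0 < \<theta>" "\<theta> < pi / 2" "\<phi> \<in> {- \<theta> / 2 <..< \<theta> / 2}"
    using assms by auto
  have main: "((\<lambda>r. operator_norm (resolvent (H_op m \<theta>) (w + of_real r * exp (\<i> * of_real \<phi>))))
      \<longlongrightarrow> \<infinity>) F" if F: "filterlim (\<lambda>r::real. \<bar>r\<bar>) at_top F" for w F
  proof -
    \<comment> \<open>The offset \<open>w\<close>, later \<open>m\<close> or \<open>- m\<close>,
      becomes the shift \<open>\<delta> = w / cis \<phi>\<close>.\<close>
    have z: "w + of_real r * exp (\<i> * of_real \<phi>) = cis \<phi> * (of_real r + w / cis \<phi>)" for r
      by (simp add: cis_conv_exp field_simps)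
    obtain B where B: "B > 0"
      "\<And>r::real. operator_norm (resolvent (H_op m \<theta>) (cis \<phi> * (of_real r + w / cis \<phi>)))
       \<ge> ennreal (B * norm (cis \<phi> * (of_real r + w / cis \<phi>) + of_real m))"
      using operator_norm_resolvent_lower_bound[OF \<theta>, where m = m and \<delta> = "w / cis \<phi>"] by metis
    have "((\<lambda>r. ennreal (B * norm (cis \<phi> * (of_real r + w / cis \<phi>) + of_real m))) \<longlongrightarrow> \<infinity>) F"
      using tendsto_norm_cis_ray[OF F B(1)]
      by (simp add: ennreal_tendsto_top_eq_at_top infinity_ennreal_def)
    then show ?thesis
      unfolding z
      by (rule tendsto_sandwich[OF _ _ _ tendsto_const, rotated 2]) (use B(2) in auto)
  qed
  show "((\<lambda>r::real. operator_norm
        (resolvent (H_op m \<theta>) (of_real m + of_real r * exp (\<i> * of_real \<phi>))))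
      \<longlongrightarrow> \<infinity>) at_top \<and>
    ((\<lambda>r::real. operator_norm
        (resolvent (H_op m \<theta>) (- of_real m + of_real r * exp (\<i> * of_real \<phi>))))
      \<longlongrightarrow> \<infinity>) at_bot"
    by (intro conjI main filterlim_abs_real
        filterlim_at_infinity_imp_norm_at_top[where f = "\<lambda>x::real. x", unfolded real_norm_def]
        filterlim_mono[OF filterlim_ident at_bot_le_at_infinity order_refl])
qed

end
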